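(* Let $\{X_\rho\}_{0<\rho\le\rho_0}$ be a Banach scale with norms $\|\cdot\|_\rho$, and let $F(t,u)$ be a map depending on a time $t$ and a path $u$ in the scale. Suppose that there exist $\rho_0>0$, $R>0$, $\beta_0>0$ and $0<T<\rho_0/\beta_0$ such that the following hold. (CK1) For every pair $\rho,\rho'$ with $0<\rho'<\rho<\rho_0-\beta_0T$ and every $u\in X_{\rho,T}(R)$, the function $t\mapsto F(t,u)$, $[0,T)\to X_{\rho'}$, is continuous. (CK2) For every $\rho$ with $0<\rho\le\rho_0-\beta_0T$, the function $t\mapsto F(t,0)$ on $[0,T)$ takes values in the ball of radius $R$ of $X_\rho$ and is continuous in $t$, and there is a constant $R_0<R$ with $$\|F(t,0)\|_{\rho_0-\beta_0t}\le R_0<R\qquad\text{for all }t\in[0,T).$$ (CK3) There is a constant $C$, independent of $\beta$, such that for every $\beta\ge\beta_0$, every $0\le t<T_\beta:=\min(T,\rho_0/\beta)$, every $\rho'>0$, every function $\rho(\cdot)$ on $[0,t]$ with $0<\rho'<\rho(s)<\rho_0-\beta s$ for all $s\in[0,t]$, and all $u_1,u_2\in Y_{\rho_0,\beta,T_\beta}(R)$, $$\|F(t,u_1)-F(t,u_2)\|_{\rho'}\le C\int_0^t\frac{\|u_1(s)-u_2(s)\|_{\rho(s)}}{\rho(s)-\rho'}\,ds .$$ Then there exist $\beta>\beta_0$ and $0<T^*\le T$ (with $T^*\le\rho_0/\beta$) such that there is a unique $u\in Y_{\rho_0,\beta,T^*}(R)$ solving the equation $$u(t)=F(t,u),\qquad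 t\in[0,T^* ).$$
   Context: A Banach scale $\{X_\rho\}_{0<\rho\le\rho_0}$ is a collection of Banach spaces with norms $\|\cdot\|_\rho$ such that $X_{\rho'}\subset X_{\rho''}$ and $\|\cdot\|_{\rho''}\le\|\cdot\|_{\rho'}$ whenever $0<\rho''\le\rho'\le\rho_0$. For $\tau>0$, $0<\rho\le\rho_0$: $X_{\rho,\tau}$ is the set of functions $u:[0,\tau]\to X_\rho$ with norm $\|u\|_{\rho,\tau}=\sup_{0\le t\le\tau}\|u(t)\|_\rho$ finite. For $\beta>0$ with $\rho-\beta\tau\ge0$, $Y_{\rho,\beta,\tau}$ is the set of functions $u$ on $[0,\tau)$ with $u(t)\in X_{\rho-\beta t}$ for each $t\in[0,\tau)$ and norm $\|u\|_{\rho,\beta,\tau}=\sup_{0\le t<\tau}\|u(t)\|_{\rho-\beta t}$ finite. $X_{\rho,\tau}(R)$ and $Y_{\rho,\beta,\tau}(R)$ denote the balls of radius $R$ in $X_{\rho,\tau}$ and $Y_{\rho,\beta,\tau}$ respectively. $F(t,u)$ takes values in $\bigcup_{\rho}X_\rho$ and is defined for the paths $u$ in the balls $X_{\rho,T}(R)$, $Y_{\rho_0,\beta,T_\beta}(R)$ appearing in the hypotheses, and for their restrictions to shorter time intervals containing $[0,t]$, with a value unaffected by such restriction. "$u=F(t,u)$" means equality for every time $t$ in the interval. *)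

theory Defs
  imports "HOL-Analysis.Analysis"
begin

text \<open>The spaces of a scale are linear subspaces of one ambient real vector space, each with its own
  norm; a norm is only meaningful on its subspace.\<close>

definition norm_on :: "'a::real_vector set \<Rightarrow> ('a \<Rightarrow> real) \<Rightarrow> bool" where
  "norm_on V n \<longleftrightarrow> subspace V \<and>
     (\<forall>x\<in>V. 0 \<le> n x \<and> (n x = 0 \<longleftrightarrow> x = 0)) \<and>
     (\<forall>c. \<forall>x\<in>V. n (c *\<^sub>R x) = \<bar>c\<bar> * n x) \<and>
     (\<forall>x\<in>V. \<forall>y\<in>V. n (x + y) \<le> n x + n y)"

text \<open>The value off \<open>V\<close> is irrelevant; it is fixed because the locale \<^locale>\<open>Metric_space\<close> asks
  for nonnegativity and symmetry on the whole type.\<close>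

definition norm_dist :: "'a::real_vector set \<Rightarrow> ('a \<Rightarrow> real) \<Rightarrow> 'a \<Rightarrow> 'a \<Rightarrow> real" where
  "norm_dist V n x y = (if x \<in> V \<and> y \<in> V then n (x - y) else 0)"

lemma Metric_space_norm_dist:
  assumes "norm_on V n"
  shows "Metric_space V (norm_dist V n)"
proof
  have sub: "subspace V" using assms by (simp add: norm_on_def)
  have sym: "n (x - y) = n (y - x)" if "x \<in> V" "y \<in> V" for x y
  proof -
    have "n ((-1) *\<^sub>R (y - x)) = \<bar>-1\<bar> * n (y - x)"
      using assms that sub by (meson norm_on_def subspace_diff)
    then show ?thesis by simp
  qed
  show "0 \<le> norm_dist V n x y" for x y
    using assms sub by (auto simp: norm_dist_def norm_on_def subspace_diff)
  show "norm_dist V n x y = norm_dist V n y x" for x y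
    using sym by (auto simp: norm_dist_def)
  show "norm_dist V n x y = 0 \<longleftrightarrow> x = y" if "x \<in> V" "y \<in> V" for x y
    using assms sub that by (simp add: norm_dist_def norm_on_def subspace_diff)
  show "norm_dist V n x z \<le> norm_dist V n x y + norm_dist V n y z"
    if "x \<in> V" "y \<in> V" "z \<in> V" for x y z
  proof -
    have "n ((x - y) + (y - z)) \<le> n (x - y) + n (y - z)"
      using assms sub that by (meson norm_on_def subspace_diff)
    then show ?thesis using that by (simp add: norm_dist_def)
  qed
qed

definition banach_on :: "'a::real_vector set \<Rightarrow> ('a \<Rightarrow> real) \<Rightarrow> bool" where
  "banach_on V n \<longleftrightarrow> norm_on V n \<and> Metric_space.mcomplete V (norm_dist V n)"

definition banach_scale ::
    "real \<Rightarrow> (real \<Rightarrow> 'a::real_vector set) \<Rightarrow> (real \<Rightarrow> 'a \<Rightarrow> real) \<Rightarrow> bool" where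
  "banach_scale \<rho>0 X N \<longleftrightarrow>
     (\<forall>\<rho>. 0 < \<rho> \<and> \<rho> \<le> \<rho>0 \<longrightarrow> banach_on (X \<rho>) (N \<rho>)) \<and>
     (\<forall>\<rho>1 \<rho>2. 0 < \<rho>2 \<and> \<rho>2 \<le> \<rho>1 \<and> \<rho>1 \<le> \<rho>0 \<longrightarrow>
        X \<rho>1 \<subseteq> X \<rho>2 \<and> (\<forall>x\<in>X \<rho>1. N \<rho>2 x \<le> N \<rho>1 x))"

text \<open>Continuity on a time set \<open>I\<close> into \<open>(V, n)\<close>, including that the values on \<open>I\<close> lie in \<open>V\<close>.\<close>

definition continuous_into ::
    "real set \<Rightarrow> 'a::real_vector set \<Rightarrow> ('a \<Rightarrow> real) \<Rightarrow> (real \<Rightarrow> 'a) \<Rightarrow> bool" where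
  "continuous_into I V n f \<longleftrightarrow>
     continuous_map (top_of_set I) (Metric_space.mtopology V (norm_dist V n)) f"

text \<open>A path on a time interval is a function that is \<^const>\<open>undefined\<close> off that interval, so that
  equality of paths is equality on the interval. Balls are closed.\<close>

definition X_paths ::
    "(real \<Rightarrow> 'a set) \<Rightarrow> (real \<Rightarrow> 'a \<Rightarrow> real) \<Rightarrow> real \<Rightarrow> real \<Rightarrow> (real \<Rightarrow> 'a) set" where
  "X_paths X N \<rho> \<tau> =
     {u \<in> {0..\<tau>} \<rightarrow>\<^sub>E X \<rho>. bdd_above ((\<lambda>t. N \<rho> (u t)) ` {0..\<tau>})}"

definition X_path_norm :: "(real \<Rightarrow> 'a \<Rightarrow> real) \<Rightarrow> real \<Rightarrow> real \<Rightarrow> (real \<Rightarrow> 'a) \<Rightarrow> real" where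
  "X_path_norm N \<rho> \<tau> u = (SUP t\<in>{0..\<tau>}. N \<rho> (u t))"

definition X_ball ::
    "(real \<Rightarrow> 'a set) \<Rightarrow> (real \<Rightarrow> 'a \<Rightarrow> real) \<Rightarrow> real \<Rightarrow> real \<Rightarrow> real \<Rightarrow> (real \<Rightarrow> 'a) set" where
  "X_ball X N \<rho> \<tau> R = {u \<in> X_paths X N \<rho> \<tau>. X_path_norm N \<rho> \<tau> u \<le> R}"

definition Y_paths ::
    "(real \<Rightarrow> 'a set) \<Rightarrow> (real \<Rightarrow> 'a \<Rightarrow> real) \<Rightarrow> real \<Rightarrow> real \<Rightarrow> real \<Rightarrow> (real \<Rightarrow> 'a) set" where
  "Y_paths X N \<rho> \<beta> \<tau> =
     {u \<in> (\<Pi>\<^sub>E t\<in>{0..<\<tau>}. X (\<rho> - \<beta> * t)). bdd_above ((\<lambda>t. N (\<rho> - \<beta> * t) (u t)) ` {0..<\<tau>})}"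

definition Y_path_norm ::
    "(real \<Rightarrow> 'a \<Rightarrow> real) \<Rightarrow> real \<Rightarrow> real \<Rightarrow> real \<Rightarrow> (real \<Rightarrow> 'a) \<Rightarrow> real" where
  "Y_path_norm N \<rho> \<beta> \<tau> u = (SUP t\<in>{0..<\<tau>}. N (\<rho> - \<beta> * t) (u t))"

definition Y_ball ::
    "(real \<Rightarrow> 'a set) \<Rightarrow> (real \<Rightarrow> 'a \<Rightarrow> real) \<Rightarrow> real \<Rightarrow> real \<Rightarrow> real \<Rightarrow> real \<Rightarrow> (real \<Rightarrow> 'a) set" where
  "Y_ball X N \<rho> \<beta> \<tau> R = {u \<in> Y_paths X N \<rho> \<beta> \<tau>. Y_path_norm N \<rho> \<beta> \<tau> u \<le> R}"

text \<open>For every time \<open>t \<in> D\<close> and every path \<open>u \<in> B\<close>, where the paths in \<open>B\<close> live on the interval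
  \<open>I\<close>: the value \<open>F t u\<close> lies in the union of the scale, and restricting \<open>u\<close> to a shorter
  interval that contains \<open>{0..t}\<close> does not change it.\<close>

definition scale_map_on ::
    "real \<Rightarrow> (real \<Rightarrow> 'a set) \<Rightarrow> (real \<Rightarrow> (real \<Rightarrow> 'a) \<Rightarrow> 'a) \<Rightarrow>
     real set \<Rightarrow> real set \<Rightarrow> (real \<Rightarrow> 'a) set \<Rightarrow> bool" where
  "scale_map_on \<rho>0 X F D I B \<longleftrightarrow>
     (\<forall>t\<in>D. \<forall>u\<in>B. F t u \<in> (\<Union>\<rho>\<in>{0<..\<rho>0}. X \<rho>) \<and>
        (\<forall>J. is_interval J \<and> {0..t} \<subseteq> J \<and> J \<subseteq> I \<longrightarrow> F t (restrict u J) = F t u))"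

text \<open>The paths carry no measurability condition in time, so an integrand built from them need not be
  measurable. The upper integral is defined for all integrands and is the Lebesgue integral for
  measurable ones.\<close>

definition upper_nn_integral :: "'b measure \<Rightarrow> ('b \<Rightarrow> ennreal) \<Rightarrow> ennreal" where
  "upper_nn_integral M f =
     (INF g\<in>{g \<in> borel_measurable M. \<forall>x\<in>space M. f x \<le> g x}. integral\<^sup>N M g)"

lemma upper_nn_integral_eq_nn_integral:
  assumes "f \<in> borel_measurable M"
  shows "upper_nn_integral M f = integral\<^sup>N M f"
  unfolding upper_nn_integral_def
  using assms by (intro antisym INF_lower INF_greatest nn_integral_mono) auto

end

theory Submission
  imports Defs
begin

text \<open>The iterates \<open>u\<^sub>0 = 0\<close>, \<open>u\<^sub>k\<^sub>+\<^sub>1(t) = F(t, u\<^sub>k)\<close> are followed through cones of increasing slopes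
  \<open>b\<^sub>k\<close>. If \<open>\<parallel>w(t)\<parallel>\<^sub>\<rho> \<le> A t / (\<rho>\<^sub>0 - \<rho> - b t)\<close> for a difference \<open>w\<close> of two paths, then (CK3), with
  \<open>\<rho>(s)\<close> halfway between \<open>\<rho>'\<close> and \<open>\<rho>\<^sub>0 - b s\<close>, gives the same bound for the difference of the
  images with \<open>A\<close> replaced by \<open>4 C A / b\<close>. At slope \<open>b\<^sub>k\<close> this norm of \<open>u\<^sub>k\<^sub>+\<^sub>2 - u\<^sub>k\<^sub>+\<^sub>1\<close> is at most
  \<open>A 4\<^sup>-\<^sup>k\<close>; on passing to \<open>b\<^sub>k\<^sub>+\<^sub>1 = b\<^sub>k + D 2\<^sup>-\<^sup>k\<close> the weight is bounded and the difference has norm at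
  most \<open>(A / D) 2\<^sup>-\<^sup>k\<close> in the narrower cone. For large \<open>D\<close> all iterates stay in the ball of radius
  \<open>R\<close> and they converge in the cone of slope \<open>\<beta> = lim b\<^sub>k\<close>. Uniqueness is the same contraction
  at the slope \<open>\<beta>\<close>.\<close>

section \<open>Norms on subspaces and geometric limits\<close>

lemma norm_on_subspace: "norm_on V n \<Longrightarrow> subspace V"
  by (simp add: norm_on_def)

lemma norm_on_triangle:
  assumes "norm_on V n" "x \<in> V" "y \<in> V"
  shows "n (x + y) \<le> n x + n y"
  using assms by (simp add: norm_on_def)

lemma norm_on_diff_commute:
  assumes "norm_on V n" "x \<in> V" "y \<in> V"
  shows "n (x - y) = n (y - x)"
proof -
  have "n ((-1) *\<^sub>R (y - x)) = \<bar>-1\<bar> * n (y - x)"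
    using assms by (meson norm_on_def subspace_diff)
  then show ?thesis by simp
qed

lemma norm_on_diff_triangle:
  assumes "norm_on V n" "x \<in> V" "y \<in> V" "z \<in> V"
  shows "n (x - z) \<le> n (x - y) + n (y - z)"
proof -
  have "n ((x - y) + (y - z)) \<le> n (x - y) + n (y - z)"
    using assms by (meson norm_on_def subspace_diff)
  then show ?thesis by simp
qed

lemma norm_on_diff_le:
  assumes "norm_on V n" "x \<in> V" "y \<in> V"
  shows "n (x - y) \<le> n x + n y"
  using norm_on_diff_triangle[OF assms(1,2) _ assms(3), of 0] norm_on_diff_commute[OF assms(1), of 0 y]
    assms by (simp add: norm_on_def subspace_0)

text \<open>Summing the steps bounds every later deviation from \<open>x k\<close> by a geometric
  tail, which gives the Cauchy property and passes to the limit. The explicit rate is needed later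
  to compare the limit with its image.\<close>

lemma banach_on_geometric_limit:
  fixes x :: "nat \<Rightarrow> 'a::real_vector"
  assumes ban: "banach_on V n" and xV: "\<And>k. x k \<in> V"
    and step: "\<And>k. n (x (Suc k) - x k) \<le> a / 2 ^ k"
  shows "\<exists>l\<in>V. \<forall>k. n (x k - l) \<le> 2 * a / 2 ^ k"
proof -
  have nrm: "norm_on V n" using ban by (simp add: banach_on_def)
  interpret M: Metric_space V "norm_dist V n" by (rule Metric_space_norm_dist[OF nrm])
  have n0: "n 0 = 0" using nrm by (simp add: norm_on_def subspace_0)
  have "0 \<le> n (x 1 - x 0)" using nrm xV by (simp add: norm_on_def subspace_diff)
  then have a: "0 \<le> a" using step[of 0] by simp
  \<comment> \<open>The exact partial sum is carried along because the weaker bound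
    \<open>2 * a / 2 ^ k\<close> would not survive the induction on \<open>m\<close>.\<close>
  have tele: "n (x (k + m) - x k) \<le> 2 * a / 2 ^ k - 2 * a / 2 ^ (k + m)" for k m
  proof (induction m)
    case 0
    then show ?case by (simp add: n0)
  next
    case (Suc m)
    have "n (x (k + Suc m) - x k) \<le> n (x (Suc (k + m)) - x (k + m)) + n (x (k + m) - x k)"
      using norm_on_diff_triangle[OF nrm xV xV xV] by simp
    also have "\<dots> \<le> a / 2 ^ (k + m) + (2 * a / 2 ^ k - 2 * a / 2 ^ (k + m))"
      by (intro add_mono step Suc.IH)
    also have "\<dots> = 2 * a / 2 ^ k - 2 * a / 2 ^ (k + Suc m)"
      by (simp add: field_simps)
    finally show ?case .
  qed
  have tail: "n (x k - x j) \<le> 2 * a / 2 ^ k" if "k \<le> j" for j k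
  proof -
    have "0 \<le> 2 * a / 2 ^ (k + (j - k))" using a by simp
    with tele[of k "j - k"] that show ?thesis
      by (subst norm_on_diff_commute[OF nrm xV xV]) simp
  qed
  have lim0: "(\<lambda>k. 2 * a / 2 ^ k) \<longlonglongrightarrow> 0"
    by (rule LIMSEQ_divide_realpow_zero) simp
  have "M.MCauchy x"
    unfolding M.MCauchy_def
  proof (intro conjI allI impI)
    show "range x \<subseteq> V" using xV by auto
    fix e :: real assume "0 < e"
    then have "\<forall>\<^sub>F k in sequentially. 2 * a / 2 ^ k < e"
      by (rule order_tendstoD(2)[OF lim0])
    then obtain K where K: "\<forall>k\<ge>K. 2 * a / 2 ^ k < e"
      unfolding eventually_sequentially by (rule exE)
    have ord: "norm_dist V n (x i) (x j) < e" if "K \<le> i" "i \<le> j" for i j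
    proof -
      have "n (x i - x j) < e" using tail[OF that(2)] K[rule_format, OF that(1)] by linarith
      then show ?thesis using xV by (simp add: norm_dist_def)
    qed
    show "\<exists>K. \<forall>i j. K \<le> i \<longrightarrow> K \<le> j \<longrightarrow> norm_dist V n (x i) (x j) < e"
    proof (intro exI allI impI)
      fix i j assume "K \<le> i" "K \<le> j"
      then show "norm_dist V n (x i) (x j) < e"
        using ord[of i j] ord[of j i] M.commute[of "x i" "x j"] by (cases "i \<le> j") auto
    qed
  qed
  moreover have "M.mcomplete"
    using ban unfolding banach_on_def by (rule conjunct2)
  ultimately obtain l where "limitin M.mtopology x l sequentially"
    unfolding M.mcomplete_def by blast
  then have l: "l \<in> V \<and> (\<forall>e>0. \<exists>K. \<forall>k\<ge>K. x k \<in> V \<and> norm_dist V n (x k) l < e)"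
    unfolding M.limit_metric_sequentially .
  then have lV: "l \<in> V" by (rule conjunct1)
  have "n (x k - l) \<le> 2 * a / 2 ^ k" for k
  proof (rule field_le_epsilon)
    fix e :: real assume "0 < e"
    from l[THEN conjunct2, THEN spec, THEN mp, OF this]
    obtain K where K: "\<forall>j\<ge>K. x j \<in> V \<and> norm_dist V n (x j) l < e"
      by (rule exE)
    then have "norm_dist V n (x (max k K)) l < e"
      by simp
    then have K: "n (x (max k K) - l) < e"
      using xV lV by (simp add: norm_dist_def)
    have "n (x k - l) \<le> n (x k - x (max k K)) + n (x (max k K) - l)"
      using norm_on_diff_triangle[OF nrm xV xV lV] .
    also have "\<dots> \<le> 2 * a / 2 ^ k + e"
      using tail[OF max.cobounded1, of k K] K by linarith
    finally show "n (x k - l) \<le> 2 * a / 2 ^ k + e" .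
  qed
  with lV show ?thesis by blast
qed

section \<open>Upper integrals and path balls\<close>

text \<open>The measurable majorant \<open>g\<close> competes in the infimum, so nothing is asked of
  the measurability of \<open>f\<close>, and the integral of \<open>g\<close> is read off from its
  antiderivative.\<close>

lemma upper_nn_integral_le_FTC:
  fixes g G :: "real \<Rightarrow> real"
  assumes "0 \<le> t" and meas: "g \<in> borel_measurable borel"
    and deriv: "\<And>s. s \<in> {0..t} \<Longrightarrow> DERIV G s :> g s"
    and nonneg: "\<And>s. s \<in> {0..t} \<Longrightarrow> 0 \<le> g s"
    and le: "\<And>s. s \<in> {0..t} \<Longrightarrow> f s \<le> ennreal (g s)"
  shows "upper_nn_integral (lebesgue_on {0..t}) f \<le> ennreal (G t - G 0)"
proof -
  have m: "(\<lambda>s. ennreal (g s)) \<in> borel_measurable (lebesgue_on {0..t})"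
    using meas by (intro measurable_restrict_space1 measurable_completion) simp
  have "upper_nn_integral (lebesgue_on {0..t}) f \<le> (\<integral>\<^sup>+ s. ennreal (g s) \<partial>lebesgue_on {0..t})"
    unfolding upper_nn_integral_def using m le by (intro INF_lower) simp
  also have "\<dots> = (\<integral>\<^sup>+ s. ennreal (g s) * indicator {0..t} s \<partial>lborel)"
    by (simp add: nn_integral_restrict_space nn_integral_completion)
  also have "\<dots> = ennreal (G t - G 0)"
    using assms by (intro nn_integral_FTC_Icc) (auto intro: has_field_derivative_at_within)
  finally show ?thesis .
qed

lemma upper_nn_integral_cong:
  assumes "\<And>x. x \<in> space M \<Longrightarrow> f x = g x"
  shows "upper_nn_integral M f = upper_nn_integral M g"
  using assms by (simp add: upper_nn_integral_def)

lemma scale_map_on_restrict: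
  assumes "scale_map_on \<rho>0 X F D I B" "t \<in> D" "u \<in> B" "is_interval J" "{0..t} \<subseteq> J" "J \<subseteq> I"
  shows "F t (restrict u J) = F t u"
  using assms unfolding scale_map_on_def by blast

text \<open>Pointwise form of the ball \<open>Y_ball\<close>, without the condition that paths be
  \<open>undefined\<close> off the interval. Iterates such as \<open>\<lambda>_. 0\<close> can thus
  be compared across slopes without restricting them each time.\<close>

definition cone_ball ::
    "(real \<Rightarrow> 'a set) \<Rightarrow> (real \<Rightarrow> 'a \<Rightarrow> real) \<Rightarrow> real \<Rightarrow> real \<Rightarrow> real \<Rightarrow> real \<Rightarrow> (real \<Rightarrow> 'a) set" where
  "cone_ball X N \<rho> b \<tau> R = {u. \<forall>t\<in>{0..<\<tau>}. u t \<in> X (\<rho> - b * t) \<and> N (\<rho> - b * t) (u t) \<le> R}"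

lemma Y_ball_iff_cone_ball:
  assumes "0 < \<tau>"
  shows "u \<in> Y_ball X N \<rho> b \<tau> R \<longleftrightarrow> u \<in> extensional {0..<\<tau>} \<and> u \<in> cone_ball X N \<rho> b \<tau> R"
proof
  assume u: "u \<in> Y_ball X N \<rho> b \<tau> R"
  then have "N (\<rho> - b * t) (u t) \<le> Y_path_norm N \<rho> b \<tau> u" if "t \<in> {0..<\<tau>}" for t
    unfolding Y_path_norm_def using that
    by (intro cSUP_upper) (auto simp: Y_ball_def Y_paths_def)
  with u show "u \<in> extensional {0..<\<tau>} \<and> u \<in> cone_ball X N \<rho> b \<tau> R"
    by (force simp: Y_ball_def Y_paths_def cone_ball_def PiE_iff)
next
  assume u: "u \<in> extensional {0..<\<tau>} \<and> u \<in> cone_ball X N \<rho> b \<tau> R"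
  then have "bdd_above ((\<lambda>t. N (\<rho> - b * t) (u t)) ` {0..<\<tau>})"
    by (intro bdd_aboveI2[where M = R]) (auto simp: cone_ball_def)
  \<comment> \<open>A pointwise bound passes to the supremum only over a nonempty set; this is where
    \<open>0 < \<tau>\<close> enters.\<close>
  moreover have "Y_path_norm N \<rho> b \<tau> u \<le> R"
    unfolding Y_path_norm_def using u assms
    by (intro cSUP_least) (auto simp: cone_ball_def)
  ultimately show "u \<in> Y_ball X N \<rho> b \<tau> R"
    using u by (auto simp: Y_ball_def Y_paths_def cone_ball_def PiE_iff)
qed

section \<open>The integral inequality on a family of cones\<close>

text \<open>(CK3) on the single time interval \<open>{0..<\<rho>0 / \<beta>}\<close> for all slopes
  from \<open>\<beta>0\<close> to \<open>\<beta>\<close>. As \<open>\<beta>\<close> is the largest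
  slope, every cone keeps a positive radius on this interval.\<close>

locale cone_volterra =
  fixes X :: "real \<Rightarrow> 'a::real_vector set"
    and N :: "real \<Rightarrow> 'a \<Rightarrow> real"
    and \<Phi> :: "(real \<Rightarrow> 'a) \<Rightarrow> real \<Rightarrow> 'a"
    and \<rho>0 \<beta>0 \<beta> c R :: real
  assumes scale: "banach_scale \<rho>0 X N"
    and pos: "0 < \<rho>0" "0 < \<beta>0" "\<beta>0 \<le> \<beta>" "0 \<le> c"
    and volterra: "\<And>b t \<rho>' \<rho> u1 u2. \<beta>0 \<le> b \<Longrightarrow> b \<le> \<beta> \<Longrightarrow> 0 \<le> t \<Longrightarrow> t < \<rho>0 / \<beta> \<Longrightarrow> 0 < \<rho>' \<Longrightarrow>
        (\<forall>s\<in>{0..t}. \<rho>' < \<rho> s \<and> \<rho> s < \<rho>0 - b * s) \<Longrightarrow>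
        u1 \<in> cone_ball X N \<rho>0 b (\<rho>0 / \<beta>) R \<Longrightarrow> u2 \<in> cone_ball X N \<rho>0 b (\<rho>0 / \<beta>) R \<Longrightarrow>
        \<Phi> u1 t - \<Phi> u2 t \<in> X \<rho>' \<and>
        ennreal (N \<rho>' (\<Phi> u1 t - \<Phi> u2 t)) \<le>
          ennreal c * upper_nn_integral (lebesgue_on {0..t})
            (\<lambda>s. ennreal (N (\<rho> s) (u1 s - u2 s) / (\<rho> s - \<rho>')))"
begin

abbreviation B :: "real \<Rightarrow> (real \<Rightarrow> 'a) set" where
  "B b \<equiv> cone_ball X N \<rho>0 b (\<rho>0 / \<beta>) R"

text \<open>The weighted norm of the overview being at most \<open>A\<close>: the bound may blow up
  at the boundary of the cone and vanishes at time 0.\<close>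

definition weighted_le :: "real \<Rightarrow> real \<Rightarrow> (real \<Rightarrow> 'a) \<Rightarrow> bool" where
  "weighted_le b A w \<longleftrightarrow> (\<forall>t\<in>{0..<\<rho>0 / \<beta>}. \<forall>\<rho>. 0 < \<rho> \<and> \<rho> < \<rho>0 - b * t \<longrightarrow>
     w t \<in> X \<rho> \<and> N \<rho> (w t) \<le> A * t / (\<rho>0 - \<rho> - b * t))"

lemma norm_on_X: "0 < \<rho> \<Longrightarrow> \<rho> \<le> \<rho>0 \<Longrightarrow> norm_on (X \<rho>) (N \<rho>)"
  and banach_on_X: "0 < \<rho> \<Longrightarrow> \<rho> \<le> \<rho>0 \<Longrightarrow> banach_on (X \<rho>) (N \<rho>)"
  using scale unfolding banach_scale_def banach_on_def by blast+

lemma scale_mono: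
  assumes "0 < \<rho>2" "\<rho>2 \<le> \<rho>1" "\<rho>1 \<le> \<rho>0" "x \<in> X \<rho>1"
  shows "x \<in> X \<rho>2" "N \<rho>2 x \<le> N \<rho>1 x"
proof -
  have "X \<rho>1 \<subseteq> X \<rho>2 \<and> (\<forall>x\<in>X \<rho>1. N \<rho>2 x \<le> N \<rho>1 x)"
    using scale[unfolded banach_scale_def, THEN conjunct2, rule_format, of \<rho>2 \<rho>1] assms by blast
  then show "x \<in> X \<rho>2" "N \<rho>2 x \<le> N \<rho>1 x" using assms(4) by blast+
qed

lemma cone_radius:
  assumes "0 \<le> b" "b \<le> \<beta>" "t \<in> {0..<\<rho>0 / \<beta>}"
  shows "0 < \<rho>0 - b * t" "\<rho>0 - b * t \<le> \<rho>0" "\<rho>0 - \<beta> * t \<le> \<rho>0 - b * t"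
proof -
  have "b * t \<le> \<beta> * t" using assms by (intro mult_right_mono) auto
  moreover have "\<beta> * t < \<rho>0" using assms pos by (simp add: field_simps)
  ultimately show "0 < \<rho>0 - b * t" "\<rho>0 - \<beta> * t \<le> \<rho>0 - b * t" by auto
  show "\<rho>0 - b * t \<le> \<rho>0" using assms by simp
qed

lemma cone_ball_below:
  assumes b: "0 \<le> b" "b \<le> \<beta>" and u: "u \<in> B b" and t: "t \<in> {0..<\<rho>0 / \<beta>}"
    and \<rho>: "0 < \<rho>" "\<rho> \<le> \<rho>0 - b * t"
  shows "u t \<in> X \<rho>" "N \<rho> (u t) \<le> R"
proof -
  have "u t \<in> X (\<rho>0 - b * t)" and R: "N (\<rho>0 - b * t) (u t) \<le> R"
    using u t unfolding cone_ball_def by blast+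
  note m = scale_mono[OF \<rho> cone_radius(2)[OF b t] this(1)]
  show "u t \<in> X \<rho>" by (fact m(1))
  show "N \<rho> (u t) \<le> R" using m(2) R by (rule order_trans)
qed

lemma cone_ball_mono:
  assumes b: "0 \<le> b" "b \<le> b'" "b' \<le> \<beta>" and u: "u \<in> B b"
  shows "u \<in> B b'"
  unfolding cone_ball_def
proof (intro CollectI ballI)
  fix t assume t: "t \<in> {0..<\<rho>0 / \<beta>}"
  have "0 \<le> b'" "b \<le> \<beta>" using b by auto
  moreover have "\<rho>0 - b' * t \<le> \<rho>0 - b * t" using t b by (simp add: mult_right_mono)
  ultimately show "u t \<in> X (\<rho>0 - b' * t) \<and> N (\<rho>0 - b' * t) (u t) \<le> R"
    using cone_ball_below[OF b(1) _ u t] cone_radius(1)[OF _ b(3) t] by blast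
qed

section \<open>Integral estimates for differences of images\<close>

text \<open>Common core of the two estimates that follow. At the midpoint radius both
  \<open>\<rho> - \<rho>'\<close> and the distance from \<open>\<rho>\<close> to the cone boundary
  are half of \<open>\<rho>0 - \<rho>' - b * s\<close>, so it remains to majorize the integrand by a
  derivative.\<close>

lemma image_diff_FTC:
  assumes b: "\<beta>0 \<le> b" "b \<le> \<beta>" and u: "u1 \<in> B b" "u2 \<in> B b"
    and t: "t \<in> {0..<\<rho>0 / \<beta>}" and \<rho>': "0 < \<rho>'" "\<rho>' < \<rho>0 - b * t"
    and meas: "g \<in> borel_measurable borel"
    and deriv: "\<And>s. s \<in> {0..t} \<Longrightarrow> DERIV G s :> g s"
    and le: "\<And>s \<rho>. s \<in> {0..t} \<Longrightarrow> 0 < \<rho> \<Longrightarrow> \<rho>0 - \<rho> - b * s = (\<rho>0 - \<rho>' - b * s) / 2 \<Longrightarrow>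
      0 < \<rho>0 - \<rho>' - b * s \<Longrightarrow>
      N \<rho> (u1 s - u2 s) / ((\<rho>0 - \<rho>' - b * s) / 2) \<le> g s"
  shows "\<Phi> u1 t - \<Phi> u2 t \<in> X \<rho>'" "N \<rho>' (\<Phi> u1 t - \<Phi> u2 t) \<le> c * (G t - G 0)"
proof -
  define r where "r s = (\<rho>' + (\<rho>0 - b * s)) / 2" for s
  have d: "0 < \<rho>0 - \<rho>' - b * s" if "s \<in> {0..t}" for s
  proof -
    have "b * s \<le> b * t" using that b pos by (intro mult_left_mono) auto
    then show ?thesis using \<rho>' by simp
  qed
  have r_pos: "0 < r s" and r_eq: "\<rho>0 - r s - b * s = (\<rho>0 - \<rho>' - b * s) / 2"
    and r_diff: "r s - \<rho>' = (\<rho>0 - \<rho>' - b * s) / 2" if "s \<in> {0..t}" for s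
    using d[OF that] \<rho>' by (auto simp: r_def field_simps)
  have r: "\<forall>s\<in>{0..t}. \<rho>' < r s \<and> r s < \<rho>0 - b * s"
  proof
    fix s assume "s \<in> {0..t}"
    from d[OF this] show "\<rho>' < r s \<and> r s < \<rho>0 - b * s" by (simp add: r_def field_simps)
  qed
  \<comment> \<open>The norm is known to be nonnegative only on its subspace, so membership is
    checked first. The majorant \<open>g\<close> then inherits the sign, which the integral of
    \<open>g\<close> and the monotonicity of \<open>G\<close> rely on.\<close>
  have nn: "0 \<le> N (r s) (u1 s - u2 s)" if s: "s \<in> {0..t}" for s
  proof -
    have "s \<in> {0..<\<rho>0 / \<beta>}" using s t by auto
    moreover have b0: "0 \<le> b" using b pos by simp
    moreover have rs: "r s \<le> \<rho>0 - b * s" using r s by (simp add: less_imp_le)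
    ultimately have "u1 s \<in> X (r s)" "u2 s \<in> X (r s)"
      using cone_ball_below(1)[OF _ b(2) _ _ r_pos[OF s] rs] u by blast+
    moreover have "r s \<le> \<rho>0" using rs s b0 by (simp add: order_trans)
    ultimately show ?thesis
      using norm_on_X[OF r_pos[OF s]] by (simp add: norm_on_def subspace_diff)
  qed
  have le': "N (r s) (u1 s - u2 s) / (r s - \<rho>') \<le> g s" if "s \<in> {0..t}" for s
    using le[OF that r_pos[OF that] r_eq[OF that] d[OF that]] by (simp add: r_diff[OF that])
  have g0: "0 \<le> g s" if "s \<in> {0..t}" for s
  proof -
    have "0 \<le> N (r s) (u1 s - u2 s) / (r s - \<rho>')" using nn[OF that] bspec[OF r that]
      by (intro divide_nonneg_nonneg) auto
    then show ?thesis using le'[OF that] by linarith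
  qed
  have int: "upper_nn_integral (lebesgue_on {0..t})
      (\<lambda>s. ennreal (N (r s) (u1 s - u2 s) / (r s - \<rho>'))) \<le> ennreal (G t - G 0)"
    using t by (intro upper_nn_integral_le_FTC[OF _ meas deriv g0] ennreal_leI le') auto
  have G: "0 \<le> G t - G 0"
  proof -
    have "\<exists>y. DERIV G s :> y \<and> 0 \<le> y" if "0 \<le> s" "s \<le> t" for s
      using deriv[of s] g0[of s] that by auto
    then show ?thesis using DERIV_nonneg_imp_nondecreasing[of 0 t G] t by simp
  qed
  have v: "\<Phi> u1 t - \<Phi> u2 t \<in> X \<rho>' \<and> ennreal (N \<rho>' (\<Phi> u1 t - \<Phi> u2 t)) \<le>
      ennreal c * upper_nn_integral (lebesgue_on {0..t})
        (\<lambda>s. ennreal (N (r s) (u1 s - u2 s) / (r s - \<rho>')))"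
    using t by (intro volterra[OF b _ _ \<rho>'(1) r u]) auto
  then show "\<Phi> u1 t - \<Phi> u2 t \<in> X \<rho>'" by blast
  have "ennreal (N \<rho>' (\<Phi> u1 t - \<Phi> u2 t)) \<le> ennreal c * ennreal (G t - G 0)"
    using v int by (meson mult_left_mono order_trans zero_le)
  also have "\<dots> = ennreal (c * (G t - G 0))"
    using pos G by (simp add: ennreal_mult)
  finally show "N \<rho>' (\<Phi> u1 t - \<Phi> u2 t) \<le> c * (G t - G 0)"
    using pos G by (simp add: ennreal_le_iff)
qed

text \<open>Entrance into the weighted norm from a uniform bound: the gap to the cone boundary
  decreases in time, so its value at the final time \<open>t\<close> yields a constant
  majorant.\<close>

lemma image_diff_bounded:
  assumes b: "\<beta>0 \<le> b" "b \<le> \<beta>" and u: "u1 \<in> B b" "u2 \<in> B b" and K: "0 \<le> K"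
    and le: "\<And>t. t \<in> {0..<\<rho>0 / \<beta>} \<Longrightarrow> N (\<rho>0 - b * t) (u1 t - u2 t) \<le> K"
  shows "weighted_le b (2 * c * K) (\<lambda>t. \<Phi> u1 t - \<Phi> u2 t)"
  unfolding weighted_le_def
proof (intro ballI allI impI)
  fix t \<rho>' assume t: "t \<in> {0..<\<rho>0 / \<beta>}" and r: "0 < \<rho>' \<and> \<rho>' < \<rho>0 - b * t"
  \<comment> \<open>The 2 comes from dividing by half the gap; integration over
    \<open>{0..t}\<close> supplies the factor \<open>t\<close> of the weight.\<close>
  define k where "k = 2 * K / (\<rho>0 - \<rho>' - b * t)"
  have b0: "0 \<le> b" using b pos by simp
  have "N \<rho> (u1 s - u2 s) / ((\<rho>0 - \<rho>' - b * s) / 2) \<le> k"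
    if s: "s \<in> {0..t}" and \<rho>: "0 < \<rho>" "\<rho>0 - \<rho> - b * s = (\<rho>0 - \<rho>' - b * s) / 2"
      and d: "0 < \<rho>0 - \<rho>' - b * s" for s \<rho>
  proof -
    have s': "s \<in> {0..<\<rho>0 / \<beta>}" using s t by auto
    have \<rho>s: "\<rho> \<le> \<rho>0 - b * s" using \<rho> d by (simp add: field_simps)
    have "u1 s - u2 s \<in> X (\<rho>0 - b * s)"
      using u s' norm_on_X[OF cone_radius(1,2)[OF b0 b(2) s']]
      by (auto simp: cone_ball_def norm_on_def subspace_diff)
    then have "N \<rho> (u1 s - u2 s) \<le> K"
      using scale_mono(2)[OF \<rho>(1) \<rho>s cone_radius(2)[OF b0 b(2) s']] le[OF s'] by fastforce
    then have "N \<rho> (u1 s - u2 s) / ((\<rho>0 - \<rho>' - b * s) / 2) \<le> K / ((\<rho>0 - \<rho>' - b * s) / 2)"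
      using d by (intro divide_right_mono) auto
    also have "\<dots> \<le> K / ((\<rho>0 - \<rho>' - b * t) / 2)"
      using s r b0 K d by (intro divide_left_mono mult_pos_pos) (auto intro: mult_left_mono)
    finally show ?thesis by (simp add: k_def mult.commute)
  qed
  moreover have "DERIV ((*) k) s :> k" for s
    by (auto intro!: derivative_eq_intros)
  ultimately have F: "\<Phi> u1 t - \<Phi> u2 t \<in> X \<rho>'" "N \<rho>' (\<Phi> u1 t - \<Phi> u2 t) \<le> c * (k * t - k * 0)"
    using image_diff_FTC[OF b u t, of \<rho>' "\<lambda>_. k" "(*) k"] r by simp_all
  moreover have "c * (k * t - k * 0) = 2 * c * K * t / (\<rho>0 - \<rho>' - b * t)"
    by (simp add: k_def field_simps)
  ultimately show "\<Phi> u1 t - \<Phi> u2 t \<in> X \<rho>' \<and>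
      N \<rho>' (\<Phi> u1 t - \<Phi> u2 t) \<le> 2 * c * K * t / (\<rho>0 - \<rho>' - b * t)"
    by simp
qed

text \<open>The weight and the kernel each contribute an inverse half gap. Integrating the inverse
  square of a gap that shrinks at rate \<open>b\<close> returns one inverse gap and a factor
  \<open>1 / b\<close>, so steep cones give a contraction.\<close>

lemma image_diff_weighted:
  assumes b: "\<beta>0 \<le> b" "b \<le> \<beta>" and u: "u1 \<in> B b" "u2 \<in> B b" and A: "0 \<le> A"
    and le: "weighted_le b A (\<lambda>t. u1 t - u2 t)"
  shows "weighted_le b (4 * c / b * A) (\<lambda>t. \<Phi> u1 t - \<Phi> u2 t)"
  unfolding weighted_le_def
proof (intro ballI allI impI)
  fix t \<rho>' assume t: "t \<in> {0..<\<rho>0 / \<beta>}" and r: "0 < \<rho>' \<and> \<rho>' < \<rho>0 - b * t"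
  define d where "d s = \<rho>0 - \<rho>' - b * s" for s
  \<comment> \<open>The factor \<open>s\<close> of the weight is enlarged to \<open>t\<close>, which
    leaves an elementary antiderivative \<open>G\<close> and restores the factor \<open>t\<close> in
    the result.\<close>
  define g where "g s = 4 * A * t / (d s)\<^sup>2" for s
  define G where "G s = 4 * A * t / b * (1 / d s)" for s
  have b0: "0 < b" using b pos by simp
  have dpos: "0 < d s" if "s \<in> {0..t}" for s
  proof -
    have "b * s \<le> b * t" using that b0 by (intro mult_left_mono) auto
    then show ?thesis using r by (simp add: d_def)
  qed
  have "N \<rho> (u1 s - u2 s) / ((\<rho>0 - \<rho>' - b * s) / 2) \<le> g s"
    if s: "s \<in> {0..t}" and \<rho>: "0 < \<rho>" "\<rho>0 - \<rho> - b * s = (\<rho>0 - \<rho>' - b * s) / 2" for s \<rho>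
  proof -
    have s': "s \<in> {0..<\<rho>0 / \<beta>}" using s t by auto
    have "\<rho> < \<rho>0 - b * s" using \<rho> dpos[OF s] by (simp add: d_def field_simps)
    with le s' \<rho>(1) have "N \<rho> (u1 s - u2 s) \<le> A * s / (\<rho>0 - \<rho> - b * s)"
      by (simp add: weighted_le_def)
    also have "\<dots> = A * s / (d s / 2)" by (simp add: \<rho>(2) d_def)
    also have "\<dots> \<le> A * t / (d s / 2)"
      using s A dpos[OF s] by (intro divide_right_mono mult_left_mono) auto
    finally have "N \<rho> (u1 s - u2 s) / (d s / 2) \<le> A * t / (d s / 2) / (d s / 2)"
      using dpos[OF s] by (intro divide_right_mono) auto
    then show ?thesis by (simp add: d_def[symmetric] g_def power2_eq_square mult_ac)
  qed
  moreover have "g \<in> borel_measurable borel" unfolding g_def d_def by measurable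
  moreover have "DERIV G s :> g s" if "s \<in> {0..t}" for s
    using dpos[OF that] b0 unfolding G_def g_def d_def
    by (auto intro!: derivative_eq_intros simp: power2_eq_square)
  ultimately have F: "\<Phi> u1 t - \<Phi> u2 t \<in> X \<rho>'" "N \<rho>' (\<Phi> u1 t - \<Phi> u2 t) \<le> c * (G t - G 0)"
    using image_diff_FTC[OF b u t, of \<rho>' g G] r by blast+
  have "0 \<le> G 0" using A b0 dpos[of 0] t by (simp add: G_def)
  then have "c * (G t - G 0) \<le> c * G t" using pos by (intro mult_left_mono) auto
  also have "\<dots> = 4 * c / b * A * t / (\<rho>0 - \<rho>' - b * t)" by (simp add: G_def d_def)
  finally show "\<Phi> u1 t - \<Phi> u2 t \<in> X \<rho>' \<and>
      N \<rho>' (\<Phi> u1 t - \<Phi> u2 t) \<le> 4 * c / b * A * t / (\<rho>0 - \<rho>' - b * t)"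
    using F by linarith
qed

section \<open>Weighted bounds under a change of slope\<close>

lemma norm_zero_X: "0 < \<rho> \<Longrightarrow> \<rho> \<le> \<rho>0 \<Longrightarrow> 0 \<in> X \<rho> \<and> N \<rho> 0 = 0"
  using norm_on_X[of \<rho>] by (simp add: norm_on_def subspace_0)

text \<open>Time 0 is special: cones of all slopes have the same radius there, so a steeper slope
  gains no distance from the boundary. The factor \<open>t\<close> of the weight makes up for
  it.\<close>

lemma weighted_le_at_0:
  assumes "weighted_le b A w" "0 \<le> b" "b \<le> \<beta>"
  shows "w 0 = 0"
proof -
  have \<rho>: "0 < \<rho>0 / 2" "\<rho>0 / 2 \<le> \<rho>0" "0 \<in> {0..<\<rho>0 / \<beta>}" using pos by auto
  then have w: "w 0 \<in> X (\<rho>0 / 2)" "N (\<rho>0 / 2) (w 0) \<le> 0"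
    using assms(1)[unfolded weighted_le_def, rule_format, of 0 "\<rho>0 / 2"] pos by auto
  then show ?thesis using norm_on_X[OF \<rho>(1,2)] by (force simp: norm_on_def)
qed

text \<open>On the boundary of the steeper cone the gap to the old one is
  \<open>(b' - b) * t\<close>, and its factor \<open>t\<close> cancels that of the weight.\<close>

lemma weighted_le_step:
  assumes b: "0 \<le> b" "b < b'" "b' \<le> \<beta>" and A: "0 \<le> A" and w: "weighted_le b A w"
    and t: "t \<in> {0..<\<rho>0 / \<beta>}"
  shows "w t \<in> X (\<rho>0 - b' * t)" "N (\<rho>0 - b' * t) (w t) \<le> A / (b' - b)"
proof -
  have r: "0 < \<rho>0 - b' * t" "\<rho>0 - b' * t \<le> \<rho>0" using cone_radius[of b' t] b t by auto
  have "w t \<in> X (\<rho>0 - b' * t) \<and> N (\<rho>0 - b' * t) (w t) \<le> A / (b' - b)"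
  proof (cases "t = 0")
    case True
    then show ?thesis using weighted_le_at_0[OF w] norm_zero_X[OF r] b A by simp
  next
    case False
    then have "b * t < b' * t" using t b by simp
    then have "w t \<in> X (\<rho>0 - b' * t)"
      "N (\<rho>0 - b' * t) (w t) \<le> A * t / (\<rho>0 - (\<rho>0 - b' * t) - b * t)"
      using w[unfolded weighted_le_def, rule_format, OF t, of "\<rho>0 - b' * t"] r by auto
    moreover have "\<rho>0 - (\<rho>0 - b' * t) - b * t = (b' - b) * t" by (simp add: algebra_simps)
    ultimately show ?thesis using False by simp
  qed
  then show "w t \<in> X (\<rho>0 - b' * t)" "N (\<rho>0 - b' * t) (w t) \<le> A / (b' - b)" by blast+
qed

lemma weighted_le_mono:
  assumes "0 \<le> b" "b \<le> b'" "b' \<le> \<beta>" "0 \<le> A" "weighted_le b A w"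
  shows "weighted_le b' A w"
  unfolding weighted_le_def
proof (intro ballI allI impI)
  fix t \<rho> assume t: "t \<in> {0..<\<rho>0 / \<beta>}" and \<rho>: "0 < \<rho> \<and> \<rho> < \<rho>0 - b' * t"
  have bt: "b * t \<le> b' * t" using t assms by (intro mult_right_mono) auto
  then have "w t \<in> X \<rho>" "N \<rho> (w t) \<le> A * t / (\<rho>0 - \<rho> - b * t)"
    using assms(5)[unfolded weighted_le_def, rule_format, OF t, of \<rho>] \<rho> by auto
  moreover have "A * t / (\<rho>0 - \<rho> - b * t) \<le> A * t / (\<rho>0 - \<rho> - b' * t)"
    using bt \<rho> t assms by (intro divide_left_mono mult_pos_pos) auto
  ultimately show "w t \<in> X \<rho> \<and> N \<rho> (w t) \<le> A * t / (\<rho>0 - \<rho> - b' * t)" by auto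
qed

text \<open>The threshold \<open>16 * c \<le> b\<close> makes \<open>4 * c / b\<close> at most 1/4.
  A factor below 1/2 is wanted because the slope increments are halved at each step of the existence
  proof.\<close>

lemma image_diff_contraction:
  assumes b: "\<beta>0 \<le> b" "b \<le> \<beta>" "16 * c \<le> b" and u: "u1 \<in> B b" "u2 \<in> B b" and A: "0 \<le> A"
    and le: "weighted_le b A (\<lambda>t. u1 t - u2 t)"
  shows "weighted_le b (A / 4) (\<lambda>t. \<Phi> u1 t - \<Phi> u2 t)"
  unfolding weighted_le_def
proof (intro ballI allI impI)
  fix t \<rho> assume t: "t \<in> {0..<\<rho>0 / \<beta>}" and \<rho>: "0 < \<rho> \<and> \<rho> < \<rho>0 - b * t"
  have "4 * c / b \<le> 1 / 4" using b pos by (simp add: divide_le_eq)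
  then have "4 * c / b * (A * (t / (\<rho>0 - \<rho> - b * t))) \<le> 1 / 4 * (A * (t / (\<rho>0 - \<rho> - b * t)))"
    using A t \<rho> by (intro mult_right_mono mult_nonneg_nonneg divide_nonneg_nonneg) auto
  then show "\<Phi> u1 t - \<Phi> u2 t \<in> X \<rho> \<and>
      N \<rho> (\<Phi> u1 t - \<Phi> u2 t) \<le> A / 4 * t / (\<rho>0 - \<rho> - b * t)"
    using image_diff_weighted[OF b(1,2) u A le, unfolded weighted_le_def, rule_format, OF t, of \<rho>] \<rho>
    by auto
qed

lemma weighted_le_imp_zero:
  assumes b: "0 \<le> b" "b \<le> \<beta>" and A: "\<And>n. weighted_le b (A n) w" and lim: "A \<longlonglongrightarrow> 0"
    and t: "t \<in> {0..<\<rho>0 / \<beta>}"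
  shows "w t = 0"
proof -
  define \<rho> where "\<rho> = (\<rho>0 - b * t) / 2"
  have \<rho>: "0 < \<rho>" "\<rho> < \<rho>0 - b * t" "\<rho> \<le> \<rho>0" using cone_radius[OF b t] by (auto simp: \<rho>_def)
  have w: "w t \<in> X \<rho>" "N \<rho> (w t) \<le> A n * t / (\<rho>0 - \<rho> - b * t)" for n
    using A[of n, unfolded weighted_le_def, rule_format, OF t, of \<rho>] \<rho> by auto
  have "(\<lambda>n. A n * (t / (\<rho>0 - \<rho> - b * t))) \<longlonglongrightarrow> 0 * (t / (\<rho>0 - \<rho> - b * t))"
    by (intro tendsto_intros lim)
  then have "N \<rho> (w t) \<le> 0"
    using w(2) by (intro LIMSEQ_le_const) auto
  then show ?thesis using w(1) norm_on_X[OF \<rho>(1,3)] by (force simp: norm_on_def)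
qed

section \<open>Uniqueness and existence of the fixed point\<close>

text \<open>The difference of two fixed points is the difference of their images, so the contraction
  applies to it repeatedly at the fixed slope \<open>\<beta>\<close> and forces its weighted norm to
  0.\<close>

lemma fixed_point_unique:
  assumes c: "16 * c \<le> \<beta>" and R: "0 \<le> R"
    and u: "u \<in> B \<beta>" "\<And>t. t \<in> {0..<\<rho>0 / \<beta>} \<Longrightarrow> u t = \<Phi> u t"
    and v: "v \<in> B \<beta>" "\<And>t. t \<in> {0..<\<rho>0 / \<beta>} \<Longrightarrow> v t = \<Phi> v t"
    and t: "t \<in> {0..<\<rho>0 / \<beta>}"
  shows "u t = v t"
proof -
  have \<beta>: "0 \<le> \<beta>" using pos by simp
  have cong: "weighted_le \<beta> A (\<lambda>t. u t - v t)" if "weighted_le \<beta> A (\<lambda>t. \<Phi> u t - \<Phi> v t)" for A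
    using that u(2) v(2) by (simp add: weighted_le_def)
  have "weighted_le \<beta> (4 * c * R / 4 ^ n) (\<lambda>t. u t - v t)" for n
  proof (induction n)
    \<comment> \<open>The initial constant \<open>4 * c * R\<close> is
      \<open>2 * c * (2 * R)\<close>, since two elements of the ball differ by at most
      \<open>2 * R\<close>.\<close>
    case 0
    have "N (\<rho>0 - \<beta> * t) (u t - v t) \<le> 2 * R" if t: "t \<in> {0..<\<rho>0 / \<beta>}" for t
    proof -
      have "u t \<in> X (\<rho>0 - \<beta> * t)" "N (\<rho>0 - \<beta> * t) (u t) \<le> R"
        "v t \<in> X (\<rho>0 - \<beta> * t)" "N (\<rho>0 - \<beta> * t) (v t) \<le> R"
        using u(1) v(1) t unfolding cone_ball_def by blast+
      then show ?thesis
        using norm_on_diff_le[OF norm_on_X[OF cone_radius(1,2)[OF \<beta> order_refl t]]] by fastforce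
    qed
    from cong[OF image_diff_bounded[OF pos(3) order_refl u(1) v(1) _ this]] R
    show ?case by (simp add: mult_ac)
  next
    case (Suc n)
    have "0 \<le> 4 * c * R / 4 ^ n" using R pos by simp
    from cong[OF image_diff_contraction[OF pos(3) order_refl c u(1) v(1) this Suc]]
    show ?case by (simp add: mult_ac)
  qed
  moreover have "(\<lambda>n. 4 * c * R / 4 ^ n) \<longlonglongrightarrow> 0"
    by (rule LIMSEQ_divide_realpow_zero) simp
  ultimately have "u t - v t = 0" 
    by (rule weighted_le_imp_zero[OF \<beta> order_refl _ _ t])
  then show ?thesis by simp
qed

text \<open>The slope increments \<open>D / 2 ^ k\<close> use up \<open>2 * D\<close>, and the
  increments of the iterates add up to at most \<open>4 * c * R0 / D\<close>. The hypotheses on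
  \<open>\<beta>\<close> and \<open>R\<close> leave room for exactly these two sums.\<close>

lemma fixed_point_exists:
  assumes b: "\<beta>0 \<le> b" "16 * c \<le> b" "b + 2 * D \<le> \<beta>" and D: "0 < D"
    and R0: "0 \<le> R0" "R0 + 4 * c * R0 / D \<le> R"
    and zero: "\<And>t. t \<in> {0..<\<rho>0 / \<beta>} \<Longrightarrow>
      \<Phi> (\<lambda>_. 0) t \<in> X (\<rho>0 - b * t) \<and> N (\<rho>0 - b * t) (\<Phi> (\<lambda>_. 0) t) \<le> R0"
  shows "\<exists>u\<in>B \<beta>. \<forall>t\<in>{0..<\<rho>0 / \<beta>}. u t = \<Phi> u t"
proof -
  \<comment> \<open>The weighted constant of \<open>u 2 - u 1\<close>:
    \<open>image_diff_bounded\<close> applied to \<open>u 1 - u 0\<close>, which is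
    \<open>u 1\<close> and has norm at most \<open>R0\<close>.\<close>
  define A where "A = 2 * c * R0"
  define bb :: "nat \<Rightarrow> real" where "bb k = b + 2 * D - 2 * D / 2 ^ k" for k
  define u where "u k = (\<Phi> ^^ k) (\<lambda>_. 0)" for k
  have u0: "u 0 = (\<lambda>_. 0)" and uS: "u (Suc k) = \<Phi> (u k)" for k by (auto simp: u_def)
  have A0: "0 \<le> A" using pos R0 by (simp add: A_def)
  have R: "0 \<le> R" "R0 + 2 * A / D \<le> R"
  proof -
    show "R0 + 2 * A / D \<le> R" using R0 by (simp add: A_def)
    moreover have "0 \<le> 2 * A / D" using A0 D by simp
    ultimately show "0 \<le> R" using R0(1) by linarith
  qed
  have "2 * D / 2 ^ k \<le> 2 * D" "0 < 2 * D / 2 ^ k" for k using D by (auto simp: field_simps)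
  then have bb: "b \<le> bb k" "bb k < \<beta>" for k
    using b by (auto simp: bb_def) (smt (verit))
  have bb': "\<beta>0 \<le> bb k" "16 * c \<le> bb k" "0 \<le> bb k" "bb k \<le> \<beta>" for k
    using bb[of k] b pos by auto
  have bb_step: "bb (Suc k) - bb k = D / 2 ^ k" for k by (simp add: bb_def field_simps)
  have bb_less: "bb k < bb (Suc k)" for k
  proof -
    have "0 < D / 2 ^ k" using D by simp
    then show ?thesis using bb_step[of k] by linarith
  qed
  have gap: "A / 4 ^ k / (bb (Suc k) - bb k) = A / D / 2 ^ k" for k
    using D by (simp add: bb_step power_mult_distrib[symmetric] field_simps)
  \<comment> \<open>Both iterates must lie in the ball at the same slope for the contraction to
    apply. The norm bound is \<open>R0\<close> plus the sum of \<open>A / D / 2 ^ j\<close> over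
    \<open>j < k\<close>.\<close>
  have inv: "u k \<in> B (bb k) \<and> u (Suc k) \<in> B (bb k) \<and>
      (\<forall>t\<in>{0..<\<rho>0 / \<beta>}. N (\<rho>0 - bb k * t) (u (Suc k) t) \<le> R0 + 2 * A / D * (1 - 1 / 2 ^ k)) \<and>
      weighted_le (bb k) (A / 4 ^ k) (\<lambda>t. u (Suc (Suc k)) t - u (Suc k) t)" for k
  proof (induction k)
    case 0
    have b0: "bb 0 = b" by (simp add: bb_def)
    have b1: "0 \<le> b" "b \<le> \<beta>" using bb'[of 0] b0 by auto
    have "R0 \<le> R" using R A0 D by (smt (verit) divide_nonneg_pos)
    then have B: "u 0 \<in> B b" "u 1 \<in> B b"
      using zero norm_zero_X[OF cone_radius(1,2)[OF b1]] R(1)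
      by (force simp: cone_ball_def u0 uS)+
    moreover have "weighted_le b (2 * c * R0) (\<lambda>t. \<Phi> (u 1) t - \<Phi> (u 0) t)"
      using zero by (intro image_diff_bounded[OF b(1) b1(2) B(2,1) R0(1)]) (simp add: u0 uS)
    ultimately show ?case using zero by (simp add: b0 uS u0 A_def)
  next
    case (Suc k)
    let ?b = "bb (Suc k)"
    have w: "weighted_le (bb k) (A / 4 ^ k) (\<lambda>t. u (Suc (Suc k)) t - u (Suc k) t)"
      using Suc by blast
    have A4: "0 \<le> A / 4 ^ k" using A0 by simp
    have B1: "u (Suc k) \<in> B ?b"
      using Suc cone_ball_mono[OF bb'(3) _ bb'(4)] bb_less less_imp_le by blast
    have bound: "u (Suc (Suc k)) t \<in> X (\<rho>0 - ?b * t) \<and>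
        N (\<rho>0 - ?b * t) (u (Suc (Suc k)) t) \<le> R0 + 2 * A / D * (1 - 1 / 2 ^ Suc k)"
      if t: "t \<in> {0..<\<rho>0 / \<beta>}" for t
    proof -
      have r: "0 < \<rho>0 - ?b * t" "\<rho>0 - ?b * t \<le> \<rho>0" "\<rho>0 - ?b * t \<le> \<rho>0 - bb k * t"
        "\<rho>0 - bb k * t \<le> \<rho>0"
        using cone_radius[OF bb'(3,4) t] t bb_less[of k] by (auto intro: mult_right_mono)
      let ?d = "u (Suc (Suc k)) t - u (Suc k) t"
      note nrm = norm_on_X[OF r(1,2)]
      have d: "?d \<in> X (\<rho>0 - ?b * t)" "N (\<rho>0 - ?b * t) ?d \<le> A / D / 2 ^ k"
        using weighted_le_step[OF bb'(3) bb_less bb'(4) A4 w t] by (simp_all only: gap)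
      have "u (Suc k) t \<in> X (\<rho>0 - bb k * t)"
        and e: "N (\<rho>0 - bb k * t) (u (Suc k) t) \<le> R0 + 2 * A / D * (1 - 1 / 2 ^ k)"
        using Suc t unfolding cone_ball_def by blast+
      note m = scale_mono[OF r(1,3,4) this(1)]
      have s: "?d + u (Suc k) t = u (Suc (Suc k)) t" by simp
      have "N (\<rho>0 - ?b * t) (?d + u (Suc k) t) \<le> N (\<rho>0 - ?b * t) ?d + N (\<rho>0 - ?b * t) (u (Suc k) t)"
        by (rule norm_on_triangle[OF nrm d(1) m(1)])
      also have "\<dots> \<le> A / D / 2 ^ k + (R0 + 2 * A / D * (1 - 1 / 2 ^ k))"
        using d(2) m(2) e by linarith
      also have "\<dots> = R0 + 2 * A / D * (1 - 1 / 2 ^ Suc k)"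
        using D by (simp add: field_simps)
      finally show ?thesis
        using subspace_add[OF norm_on_subspace[OF nrm] d(1) m(1)] unfolding s by blast
    qed
    have "R0 + 2 * A / D * (1 - 1 / 2 ^ Suc k) \<le> R0 + 2 * A / D * 1"
      using A0 D by (intro add_left_mono mult_left_mono) auto
    then have B2: "u (Suc (Suc k)) \<in> B ?b"
      using bound R(2) unfolding cone_ball_def by fastforce
    have "weighted_le ?b (A / 4 ^ k) (\<lambda>t. u (Suc (Suc k)) t - u (Suc k) t)"
      using w A4 bb'(3,4) bb_less less_imp_le by (blast intro: weighted_le_mono)
    from image_diff_contraction[OF bb'(1,4,2) B2 B1 A4 this] B1 B2 bound
    show ?case by (simp add: uS mult_ac)
  qed
  have \<beta>: "0 \<le> \<beta>" using pos by simp
  have uB: "u (Suc k) \<in> B \<beta>" for k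
    using inv[of k] cone_ball_mono[OF bb'(3,4) order_refl] by blast
  \<comment> \<open>The bounds at the various slopes are carried to the common slope
    \<open>\<beta>\<close>, where the radius is smaller and the norm no larger. The sequence starts
    at \<open>u 1\<close> because \<open>u 2 - u 1\<close> is the first difference that
    \<open>inv\<close> controls.\<close>
  have step: "N (\<rho>0 - \<beta> * t) (u (Suc (Suc k)) t - u (Suc k) t) \<le> A / D / 2 ^ k"
    if t: "t \<in> {0..<\<rho>0 / \<beta>}" for t k
  proof -
    have A4: "0 \<le> A / 4 ^ k" using A0 by simp
    have "N (\<rho>0 - \<beta> * t) (u (Suc (Suc k)) t - u (Suc k) t)
        \<le> N (\<rho>0 - bb (Suc k) * t) (u (Suc (Suc k)) t - u (Suc k) t)"
      using cone_radius[OF bb'(3,4) t, of "Suc k"] cone_radius(1)[OF \<beta> order_refl t]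
        weighted_le_step(1)[OF bb'(3) bb_less bb'(4) A4 _ t, of k] inv[of k]
      by (intro scale_mono(2)) auto
    also have "\<dots> \<le> A / D / 2 ^ k"
      using weighted_le_step(2)[OF bb'(3) bb_less bb'(4) A4 _ t, of k] inv[of k] unfolding gap by blast
    finally show ?thesis .
  qed
  have "\<exists>l\<in>X (\<rho>0 - \<beta> * t). \<forall>k. N (\<rho>0 - \<beta> * t) (u (Suc k) t - l) \<le> 2 * (A / D) / 2 ^ k"
    if t: "t \<in> {0..<\<rho>0 / \<beta>}" for t
  proof (rule banach_on_geometric_limit[OF banach_on_X[OF cone_radius(1,2)[OF \<beta> order_refl t]]])
    show "u (Suc k) t \<in> X (\<rho>0 - \<beta> * t)" for k using uB[of k] t unfolding cone_ball_def by blast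
  qed (rule step[OF t])
  then obtain v where v: "v t \<in> X (\<rho>0 - \<beta> * t)"
    "N (\<rho>0 - \<beta> * t) (u (Suc k) t - v t) \<le> 2 * (A / D) / 2 ^ k"
    if "t \<in> {0..<\<rho>0 / \<beta>}" for t k
    by metis
  have lim0: "(\<lambda>k. C / 2 ^ k) \<longlonglongrightarrow> 0" for C :: real
    by (rule LIMSEQ_divide_realpow_zero) simp
  have vB: "v \<in> B \<beta>"
    unfolding cone_ball_def
  proof (intro CollectI ballI conjI v)
    fix t assume t: "t \<in> {0..<\<rho>0 / \<beta>}"
    note nrm = norm_on_X[OF cone_radius(1,2)[OF \<beta> order_refl t]]
    have "N (\<rho>0 - \<beta> * t) (v t) \<le> R + 2 * (A / D) / 2 ^ k" for k
    proof -
      have ut: "u (Suc k) t \<in> X (\<rho>0 - \<beta> * t)" "N (\<rho>0 - \<beta> * t) (u (Suc k) t) \<le> R"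
        using uB[of k] t unfolding cone_ball_def by blast+
      have "N (\<rho>0 - \<beta> * t) (u (Suc k) t - (u (Suc k) t - v t))
          \<le> N (\<rho>0 - \<beta> * t) (u (Suc k) t) + N (\<rho>0 - \<beta> * t) (u (Suc k) t - v t)"
        using nrm ut v(1)[OF t] by (intro norm_on_diff_le[OF nrm]) (auto simp: norm_on_def subspace_diff)
      then show ?thesis using ut v(2)[OF t, of k] by simp
    qed
    moreover have "(\<lambda>k. R + 2 * (A / D) / 2 ^ k) \<longlonglongrightarrow> R + 0"
      by (intro tendsto_intros lim0)
    ultimately show "N (\<rho>0 - \<beta> * t) (v t) \<le> R" by (intro LIMSEQ_le_const) auto
  qed
  have "v t = \<Phi> v t" if t: "t \<in> {0..<\<rho>0 / \<beta>}" for t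
  proof -
    \<comment> \<open>The estimate for images degenerates at the cone boundary, so the equation is
      tested at an interior radius. Vanishing of one norm already gives equality.\<close>
    define \<rho> where "\<rho> = (\<rho>0 - \<beta> * t) / 2"
    have \<rho>: "0 < \<rho>" "\<rho> < \<rho>0 - \<beta> * t" "\<rho> \<le> \<rho>0" using cone_radius[OF \<beta> order_refl t] by (auto simp: \<rho>_def)
    note nrm = norm_on_X[OF \<rho>(1,3)]
    define K where "K = 1 + 2 * c * t / (\<rho>0 - \<rho> - \<beta> * t)"
    \<comment> \<open>Compare both \<open>v\<close> and \<open>\<Phi> v\<close> with
      \<open>u (Suc (Suc k))\<close>, which is the image of \<open>u (Suc k)\<close>. Here
      \<open>K\<close> collects the two contributions and does not depend on
      \<open>k\<close>.\<close>
    have est: "v t - \<Phi> v t \<in> X \<rho> \<and> N \<rho> (v t - \<Phi> v t) \<le> 2 * (A / D) * K / 2 ^ k" for k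
    proof -
      define e where "e = 2 * (A / D) / 2 ^ k"
      have e: "0 \<le> e" using A0 D by (simp add: e_def)
      have "weighted_le \<beta> (2 * c * e) (\<lambda>t. \<Phi> (u (Suc k)) t - \<Phi> v t)"
        using v(2) by (intro image_diff_bounded[OF pos(3) order_refl uB vB e]) (simp add: e_def)
      then have a: "u (Suc (Suc k)) t - \<Phi> v t \<in> X \<rho>"
        "N \<rho> (u (Suc (Suc k)) t - \<Phi> v t) \<le> 2 * c * e * t / (\<rho>0 - \<rho> - \<beta> * t)"
        using t \<rho> by (auto simp: weighted_le_def uS[of "Suc k"])
      have ut: "u (Suc (Suc k)) t - v t \<in> X (\<rho>0 - \<beta> * t)"
        using uB[of "Suc k"] v(1)[OF t] t norm_on_X[OF cone_radius(1,2)[OF \<beta> order_refl t]]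
        by (auto simp: cone_ball_def norm_on_def subspace_diff)
      have m: "u (Suc (Suc k)) t - v t \<in> X \<rho>"
        "N \<rho> (u (Suc (Suc k)) t - v t) \<le> N (\<rho>0 - \<beta> * t) (u (Suc (Suc k)) t - v t)"
        using scale_mono[OF \<rho>(1) less_imp_le[OF \<rho>(2)] cone_radius(2)[OF \<beta> order_refl t] ut] .
      have "N (\<rho>0 - \<beta> * t) (u (Suc (Suc k)) t - v t) \<le> 2 * (A / D) / 2 ^ Suc k"
        by (rule v(2)[OF t])
      also have "\<dots> \<le> e" using A0 D unfolding e_def by (intro divide_left_mono) auto
      finally have "N \<rho> (u (Suc (Suc k)) t - v t) \<le> e" using m by linarith
      with norm_on_diff_le[OF nrm a(1) m(1)] a(2)
      have "N \<rho> (u (Suc (Suc k)) t - \<Phi> v t - (u (Suc (Suc k)) t - v t))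
          \<le> e + 2 * c * e * t / (\<rho>0 - \<rho> - \<beta> * t)"
        by linarith
      moreover have "e + 2 * c * e * t / (\<rho>0 - \<rho> - \<beta> * t) = e * K"
        by (simp add: K_def distrib_left)
      moreover have "e * K = 2 * (A / D) * K / 2 ^ k"
        by (simp add: e_def)
      moreover have "(u (Suc (Suc k)) t - \<Phi> v t) - (u (Suc (Suc k)) t - v t) = v t - \<Phi> v t"
        by simp
      ultimately show ?thesis
        using subspace_diff[OF norm_on_subspace[OF nrm] a(1) m(1)] by simp
    qed
    then have "N \<rho> (v t - \<Phi> v t) \<le> 0"
      using lim0[of "2 * (A / D) * K"] by (intro LIMSEQ_le_const) auto
    then have "v t - \<Phi> v t = 0" using est nrm by (force simp: norm_on_def)
    then show ?thesis by simp
  qed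
  with vB show ?thesis by blast
qed

end

section \<open>Choice of the slope and transfer to the map \<open>F\<close>\<close>

theorem theorem5p3:
  fixes X :: "real \<Rightarrow> 'a::real_vector set"
    and N :: "real \<Rightarrow> 'a \<Rightarrow> real"
    and F :: "real \<Rightarrow> (real \<Rightarrow> 'a) \<Rightarrow> 'a"
    and \<rho>0 R R0 \<beta>0 T C :: real
  assumes scale: "banach_scale \<rho>0 X N"
    and params: "0 < \<rho>0" "0 < R" "0 < \<beta>0" "0 < T" "T < \<rho>0 / \<beta>0"
    and F_X: "\<And>\<rho>. 0 < \<rho> \<Longrightarrow> \<rho> < \<rho>0 - \<beta>0 * T \<Longrightarrow>
        scale_map_on \<rho>0 X F {0..<T} {0..T} (X_ball X N \<rho> T R)"
    and F_Y: "\<And>\<beta>. \<beta>0 \<le> \<beta> \<Longrightarrow>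
        scale_map_on \<rho>0 X F {0..<min T (\<rho>0 / \<beta>)} {0..<min T (\<rho>0 / \<beta>)}
          (Y_ball X N \<rho>0 \<beta> (min T (\<rho>0 / \<beta>)) R)"
    and CK1: "\<And>\<rho> \<rho>' u. 0 < \<rho>' \<Longrightarrow> \<rho>' < \<rho> \<Longrightarrow> \<rho> < \<rho>0 - \<beta>0 * T \<Longrightarrow> u \<in> X_ball X N \<rho> T R \<Longrightarrow>
        continuous_into {0..<T} (X \<rho>') (N \<rho>') (\<lambda>t. F t u)"
    and CK2_cont: "\<And>\<rho>. 0 < \<rho> \<Longrightarrow> \<rho> \<le> \<rho>0 - \<beta>0 * T \<Longrightarrow>
        (\<forall>t\<in>{0..<T}. F t (\<lambda>s\<in>{0..T}. 0) \<in> X \<rho> \<and> N \<rho> (F t (\<lambda>s\<in>{0..T}. 0)) \<le> R) \<and>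
        continuous_into {0..<T} (X \<rho>) (N \<rho>) (\<lambda>t. F t (\<lambda>s\<in>{0..T}. 0))"
    and CK2_bound: "R0 < R"
        "\<And>t. t \<in> {0..<T} \<Longrightarrow> F t (\<lambda>s\<in>{0..T}. 0) \<in> X (\<rho>0 - \<beta>0 * t) \<and>
           N (\<rho>0 - \<beta>0 * t) (F t (\<lambda>s\<in>{0..T}. 0)) \<le> R0"
    and CK3: "\<And>\<beta> t \<rho>' \<rho> u1 u2. \<beta>0 \<le> \<beta> \<Longrightarrow> 0 \<le> t \<Longrightarrow> t < min T (\<rho>0 / \<beta>) \<Longrightarrow> 0 < \<rho>' \<Longrightarrow>
        (\<forall>s\<in>{0..t}. \<rho>' < \<rho> s \<and> \<rho> s < \<rho>0 - \<beta> * s) \<Longrightarrow>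
        u1 \<in> Y_ball X N \<rho>0 \<beta> (min T (\<rho>0 / \<beta>)) R \<Longrightarrow>
        u2 \<in> Y_ball X N \<rho>0 \<beta> (min T (\<rho>0 / \<beta>)) R \<Longrightarrow>
        F t u1 - F t u2 \<in> X \<rho>' \<and>
        ennreal (N \<rho>' (F t u1 - F t u2)) \<le>
          ennreal C * upper_nn_integral (lebesgue_on {0..t})
            (\<lambda>s. ennreal (N (\<rho> s) (u1 s - u2 s) / (\<rho> s - \<rho>')))"
  shows "\<exists>\<beta> Tstar. \<beta>0 < \<beta> \<and> 0 < Tstar \<and> Tstar \<le> T \<and> Tstar \<le> \<rho>0 / \<beta> \<and>
    (\<exists>!u. u \<in> Y_ball X N \<rho>0 \<beta> Tstar R \<and> (\<forall>t\<in>{0..<Tstar}. u t = F t u))"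
proof -
  have sub0: "0 < \<rho>0 - \<beta>0 * T" using params by (simp add: field_simps)
  have nrm: "norm_on (X \<rho>) (N \<rho>)" if "0 < \<rho>" "\<rho> \<le> \<rho>0" for \<rho>
    using scale that unfolding banach_scale_def banach_on_def by blast
  then have zero: "0 \<in> X \<rho>" "N \<rho> 0 = 0" if "0 < \<rho>" "\<rho> \<le> \<rho>0" for \<rho>
    using that by (auto simp: norm_on_def subspace_0)
  have mono: "x \<in> X \<rho>2 \<and> N \<rho>2 x \<le> N \<rho>1 x"
    if "0 < \<rho>2" "\<rho>2 \<le> \<rho>1" "\<rho>1 \<le> \<rho>0" "x \<in> X \<rho>1" for \<rho>1 \<rho>2 x
    using scale[unfolded banach_scale_def, THEN conjunct2, rule_format, of \<rho>2 \<rho>1] that by blast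
  have R0: "0 \<le> R0"
    using CK2_bound(2)[of 0] nrm[of \<rho>0] params by (fastforce simp: norm_on_def)
  \<comment> \<open>\<open>C\<close> may be negative, but \<open>ennreal\<close> sends negative
    numbers to 0, so (CK3) reads the same with \<open>c\<close>.\<close>
  define c where "c = max C 0"
  have c: "0 \<le> c" "ennreal C = ennreal c" by (auto simp: c_def max_def ennreal_neg)
  define b where "b = max \<beta>0 (16 * c)"
  have b: "\<beta>0 \<le> b" "16 * c \<le> b" by (auto simp: b_def)
  \<comment> \<open>The second summand keeps the iterates in the ball of radius \<open>R\<close>;
    the third makes \<open>\<beta>\<close> so large that the cone closes no later than
    \<open>T\<close>.\<close>
  define D where "D = 1 + 4 * c * R0 / (R - R0) + \<rho>0 / T"
  define \<beta> where "\<beta> = b + 2 * D"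
  \<comment> \<open>The time at which the cone of slope \<open>\<beta>\<close> closes; it serves as
    \<open>Tstar\<close>.\<close>
  define \<tau> where "\<tau> = \<rho>0 / \<beta>"
  have q: "0 \<le> 4 * c * R0 / (R - R0)" "0 < \<rho>0 / T"
    using c R0 CK2_bound(1) params by auto
  have D: "0 < D" "4 * c * R0 / (R - R0) \<le> D" "\<rho>0 / T \<le> D"
    using q unfolding D_def by linarith+
  have RD: "R0 + 4 * c * R0 / D \<le> R"
    using D CK2_bound(1) by (simp add: field_simps)
  have \<beta>: "\<beta>0 < \<beta>" "b \<le> \<beta>" "16 * c \<le> \<beta>" "\<rho>0 / T \<le> \<beta>"
    using D b c params by (auto simp: \<beta>_def)
  have \<tau>: "0 < \<tau>" "\<tau> \<le> T"
    using \<beta> params by (auto simp: \<tau>_def field_simps)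
  define I where "I = {0..<\<tau>}"
  define \<Phi> where "\<Phi> u t = F t (restrict u I)" for u t
  \<comment> \<open>For \<open>b' < \<beta>\<close> (CK3) may concern paths on a longer interval
    than \<open>I\<close>. Extension by zero keeps the ball condition, and invariance of
    \<open>F\<close> under restriction shows that the values at times in \<open>I\<close> are those
    of \<open>\<Phi>\<close>.\<close>
  define ext where "ext b' u = (\<lambda>t\<in>{0..<min T (\<rho>0 / b')}. if t < \<tau> then u t else 0)"
    for b' and u :: "real \<Rightarrow> 'a"
  have \<tau>_le: "\<tau> \<le> min T (\<rho>0 / b')" if "\<beta>0 \<le> b'" "b' \<le> \<beta>" for b'
    using that \<tau> params by (auto simp: \<tau>_def intro!: divide_left_mono mult_pos_pos)
  have ext_ball: "ext b' u \<in> Y_ball X N \<rho>0 b' (min T (\<rho>0 / b')) R"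
    if b': "\<beta>0 \<le> b'" "b' \<le> \<beta>" and u: "u \<in> cone_ball X N \<rho>0 b' \<tau> R" for b' u
  proof -
    have "0 < \<rho>0 - b' * t \<and> \<rho>0 - b' * t \<le> \<rho>0" if "0 \<le> t" "t < \<rho>0 / b'" for t
      using that b' params by (simp add: field_simps)
    then have "ext b' u \<in> cone_ball X N \<rho>0 b' (min T (\<rho>0 / b')) R"
      using u zero params by (auto simp: cone_ball_def ext_def)
    moreover have "0 < min T (\<rho>0 / b')" using \<tau> \<tau>_le[OF b'] by linarith
    ultimately show ?thesis by (simp add: Y_ball_iff_cone_ball ext_def)
  qed
  have F_ext: "F t (ext b' u) = \<Phi> u t"
    if b': "\<beta>0 \<le> b'" "b' \<le> \<beta>" and u: "u \<in> cone_ball X N \<rho>0 b' \<tau> R" and t: "t \<in> I" for b' u t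
  proof -
    have "F t (restrict (ext b' u) I) = F t (ext b' u)"
      using t \<tau>_le[OF b']
      by (intro scale_map_on_restrict[OF F_Y[OF b'(1)] _ ext_ball[OF b' u]])
        (auto simp: I_def is_interval_co)
    moreover have "restrict (ext b' u) I = restrict u I"
      using \<tau>_le[OF b'] by (auto simp: ext_def I_def restrict_def fun_eq_iff)
    ultimately show ?thesis by (simp add: \<Phi>_def)
  qed
  \<comment> \<open>The zero path of (CK2) lives on \<open>{0..T}\<close>. It lies in the ball of
    \<open>X_paths\<close> at any admissible radius, so \<open>F_X\<close> permits its restriction
    to \<open>I\<close>.\<close>
  have \<Phi>0: "\<Phi> (\<lambda>_. 0) t = F t (\<lambda>s\<in>{0..T}. 0)" if t: "t \<in> I" for t
  proof -
    obtain \<rho> where \<rho>: "0 < \<rho>" "\<rho> < \<rho>0 - \<beta>0 * T" using dense[OF sub0] by blast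
    moreover have "0 \<le> \<beta>0 * T" using params by simp
    ultimately have \<rho>_le: "\<rho> \<le> \<rho>0" by linarith
    have "(\<lambda>s\<in>{0..T}. 0) \<in> X_ball X N \<rho> T R"
      using zero[OF \<rho>(1) \<rho>_le] params by (auto simp: X_ball_def X_paths_def X_path_norm_def)
    then have "F t (restrict (\<lambda>s\<in>{0..T}. 0) I) = F t (\<lambda>s\<in>{0..T}. 0)"
      using t \<tau> by (intro scale_map_on_restrict[OF F_X[OF \<rho>(1,2)]]) (auto simp: I_def is_interval_co)
    moreover have "restrict (\<lambda>s\<in>{0..T}. 0) I = restrict (\<lambda>_. 0 :: 'a) I"
      using \<tau> by (auto simp: I_def restrict_def fun_eq_iff)
    ultimately show ?thesis by (simp add: \<Phi>_def)
  qed
  interpret cone_volterra X N \<Phi> \<rho>0 \<beta>0 \<beta> c R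
  proof
    fix b' t \<rho>' \<rho> u1 u2
    assume b': "\<beta>0 \<le> b'" "b' \<le> \<beta>" and t: "0 \<le> t" "t < \<rho>0 / \<beta>" and \<rho>': "0 < \<rho>'"
      and \<rho>: "\<forall>s\<in>{0..t}. \<rho>' < \<rho> s \<and> \<rho> s < \<rho>0 - b' * s"
      and u: "u1 \<in> cone_ball X N \<rho>0 b' (\<rho>0 / \<beta>) R" "u2 \<in> cone_ball X N \<rho>0 b' (\<rho>0 / \<beta>) R"
    note u' = u[folded \<tau>_def]
    have t': "t < min T (\<rho>0 / b')" "t \<in> I" using t \<tau>_le[OF b'] by (auto simp: \<tau>_def I_def)
    have cong: "upper_nn_integral (lebesgue_on {0..t})
          (\<lambda>s. ennreal (N (\<rho> s) (ext b' u1 s - ext b' u2 s) / (\<rho> s - \<rho>')))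
        = upper_nn_integral (lebesgue_on {0..t})
          (\<lambda>s. ennreal (N (\<rho> s) (u1 s - u2 s) / (\<rho> s - \<rho>')))"
      using t' by (intro upper_nn_integral_cong) (auto simp: ext_def I_def)
    show "\<Phi> u1 t - \<Phi> u2 t \<in> X \<rho>' \<and>
        ennreal (N \<rho>' (\<Phi> u1 t - \<Phi> u2 t)) \<le>
          ennreal c * upper_nn_integral (lebesgue_on {0..t})
            (\<lambda>s. ennreal (N (\<rho> s) (u1 s - u2 s) / (\<rho> s - \<rho>')))"
      using CK3[OF b'(1) t(1) t'(1) \<rho>' \<rho> ext_ball[OF b' u'(1)] ext_ball[OF b' u'(2)]]
      unfolding cong F_ext[OF b' u'(1) t'(2)] F_ext[OF b' u'(2) t'(2)] c(2) .
  qed (use scale params \<beta> c in auto)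
  \<comment> \<open>The bound of (CK2) at slope \<open>\<beta>0\<close> descends to the smaller
    radius at slope \<open>b\<close>.\<close>
  have "\<Phi> (\<lambda>_. 0) t \<in> X (\<rho>0 - b * t) \<and> N (\<rho>0 - b * t) (\<Phi> (\<lambda>_. 0) t) \<le> R0"
    if t: "t \<in> {0..<\<rho>0 / \<beta>}" for t
  proof -
    have t': "t \<in> {0..<T}" "t \<in> I" using t \<tau> by (auto simp: \<tau>_def I_def)
    have "0 < \<rho>0 - b * t" "\<rho>0 - \<beta>0 * t \<le> \<rho>0" using cone_radius t b \<beta> pos by auto
    moreover have "\<rho>0 - b * t \<le> \<rho>0 - \<beta>0 * t" using t b by (simp add: mult_right_mono)
    ultimately show ?thesis
      unfolding \<Phi>0[OF t'(2)] using CK2_bound(2)[OF t'(1)] mono by (meson order_trans)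
  qed
  from fixed_point_exists[OF b _ D(1) R0 RD this]
  obtain u where u: "u \<in> cone_ball X N \<rho>0 \<beta> \<tau> R" "\<And>t. t \<in> I \<Longrightarrow> u t = \<Phi> u t"
    by (auto simp: \<beta>_def \<tau>_def I_def)
  have ex1: "\<exists>!u. u \<in> Y_ball X N \<rho>0 \<beta> \<tau> R \<and> (\<forall>t\<in>I. u t = F t u)"
  \<comment> \<open>Membership in \<open>cone_ball\<close> leaves \<open>u\<close> arbitrary off
    \<open>I\<close>. Restriction selects the one representative that is a path, so uniqueness on
    \<open>I\<close> becomes uniqueness of functions.\<close>
  proof (rule ex1I[of _ "restrict u I"])
    show "restrict u I \<in> Y_ball X N \<rho>0 \<beta> \<tau> R \<and> (\<forall>t\<in>I. restrict u I t = F t (restrict u I))"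
      using u \<tau> by (auto simp: Y_ball_iff_cone_ball cone_ball_def \<Phi>_def I_def)
  next
    fix v assume v: "v \<in> Y_ball X N \<rho>0 \<beta> \<tau> R \<and> (\<forall>t\<in>I. v t = F t v)"
    then have v': "v \<in> extensional I" "v \<in> cone_ball X N \<rho>0 \<beta> \<tau> R"
      using \<tau> by (auto simp: Y_ball_iff_cone_ball I_def)
    have v_fix: "v t = \<Phi> v t" if "t \<in> I" for t
      using v that by (simp add: \<Phi>_def extensional_restrict[OF v'(1)])
    have "v t = u t" if t: "t \<in> I" for t
      using fixed_point_unique[folded \<tau>_def I_def, OF \<beta>(3) less_imp_le[OF params(2)] v'(2) v_fix u t] .
    then show "v = restrict u I"
      using v'(1) by (intro extensionalityI[of _ I]) auto
  qed
  show ?thesis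
    using ex1 \<beta>(1) \<tau> unfolding I_def by (intro exI[of _ \<beta>] exI[of _ \<tau>]) (auto simp: \<tau>_def)
qed

end
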